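(* Consider the single-store driver-allocation POMDP defined in the context, under its standing assumptions. For every period $t\in\{1,\ldots,T\}$ and every belief $\mathbf{b}\in\Delta^{K-1}$: (i) the map $s\mapsto V_t(s,\mathbf{b})$, $s\in\mathbb{Z}_{\ge 0}$, is strictly decreasing; (ii) the smallest optimal allocation $a^*_t(s,\mathbf{b})$ is non-decreasing in $s\in\mathbb{Z}_{\ge 0}$; (iii) for every $s\in\mathbb{Z}_{\ge 0}$, $a^*_t(s,\mathbf{b}) \le a^*_t(s+v,\mathbf{b}) \le a^*_t(s,\mathbf{b})+1$.
   Context: **Parameters.** $T\ge 1$ (number of periods), $K\ge 1$ (number of demand regimes), $v\in\mathbb{Z}_{>0}$ (orders per driver per period), $x_{\max}\in\mathbb{Z}_{\ge 0}$, $a_{\min}\in\mathbb{Z}_{\ge 0}$; real numbers $p,c_a,c_p,c_b,c_{\mathrm{lost}}>0$. Put $q:=p-c_p$. $\Delta^{K-1}$ is the set of probability vectors on $\{1,\ldots,K\}$. **Standing assumptions.** $vp-vc_p-c_a>0$; $q>0$ (A1); $c_b>q$ (A2); $c_{\mathrm{lost}}>c_b$; the regime transition matrix does not depend on the action (A3); the upper bound on the action is non-binding (A4), so actions are taken in $\mathcal{A}=\{a\in\mathbb{Z}: a\ge a_{\min}\}$. **Demand and beliefs.** Fix a day of week $d$. For each period $t$ (at hour $h_t$) and regime $k$, $f_k(\cdot;d,h_t)$ is a probability mass function on $\{0,1,\ldots,x_{\max}\}$. $\mathbf{T}$ is a $K\times K$ row-stochastic matrix. Given belief $\mathbf{b}$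 at period $t$ and observed demand $x$, the next belief is $\mathbf{b}_{t+1}(x)=\mathbf{T}^\top\mathbf{b}^+$, where $b^+(j)=b(j)f_j(x;d,h_t)/\sum_{k}b(k)f_k(x;d,h_t)$ (defined arbitrarily in $\Delta^{K-1}$ when the denominator is $0$; such $x$ have weight zero below). **Reward and backlog.** With backlog $s\in\mathbb{Z}_{\ge 0}$, demand $x$ and action $a$, the reward is $$r(x,s,a)=p\min\{x+s,va\}-c_a a-c_p\min\{x+s,va\}-c_b s,$$ and the next backlog is $\max\{x+s-va,0\}$. **Value functions.** $V_{T+1}(s,\mathbf{b})=-c_{\mathrm{lost}}\,s$, and for $t=T,\ldots,1$, $$Q_t(s,\mathbf{b},a)=\sum_{k=1}^K b(k)\sum_{x=0}^{x_{\max}}\Bigl[r(x,s,a)+V_{t+1}\bigl(\max\{x+s-va,0\},\mathbf{b}_{t+1}(x)\bigr)\Bigr]f_k(x;d,h_t),$$ $V_t(s,\mathbf{b})=\max_{a\in\mathcal{A}}Q_t(s,\mathbf{b},a)$. The maximum is attained, since once $va\ge x_{\max}+s$ increasing $a$ only adds wage cost. The smallest optimal action is $a^*_t(s,\mathbf{b}):=\min\bigl(\arg\max_{a\in\mathcal{A}}Q_t(s,\mathbf{b},a)\bigr)$. *)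

theory Defs
  imports "HOL-Probability.Probability"
begin

text \<open>
  Demand regimes are the elements of a finite type \<open>'k\<close>, so \<open>K\<close> is its cardinality; \<open>'d\<close> and \<open>'h\<close>
  are the types of days of the week and of hours. Actions, backlogs and demands are natural numbers.
  The transition matrix is a constant of the model, in particular independent of the action.
  The field \<open>fallback t b x\<close> is the arbitrary value of the posterior belief for demands \<open>x\<close> that
  have probability zero under the belief \<open>b\<close>.
\<close>

record ('k::finite, 'd, 'h) driver_model =
  horizon :: nat
  capacity :: nat  \<comment> \<open>\<open>v\<close>, orders per driver and period\<close>
  max_demand :: nat
  min_action :: nat
  price :: real
  c_a :: real
  c_p :: real
  c_b :: real
  c_lost :: real
  day :: 'd
  hour :: "nat \<Rightarrow> 'h"
  demand :: "'k \<Rightarrow> 'd \<Rightarrow> 'h \<Rightarrow> nat pmf"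
  trans_matrix :: "real ^ 'k ^ 'k"
  fallback :: "nat \<Rightarrow> real ^ 'k \<Rightarrow> nat \<Rightarrow> real ^ 'k"

definition belief_simplex :: "(real ^ 'k::finite) set" where
  "belief_simplex = {b. (\<forall>k. 0 \<le> b $ k) \<and> (\<Sum>k\<in>UNIV. b $ k) = 1}"

definition row_stochastic :: "real ^ 'k::finite ^ 'k \<Rightarrow> bool" where
  "row_stochastic P \<longleftrightarrow> (\<forall>i j. 0 \<le> P $ i $ j) \<and> (\<forall>i. (\<Sum>j\<in>UNIV. P $ i $ j) = 1)"

definition margin :: "('k::finite, 'd, 'h) driver_model \<Rightarrow> real" where
  "margin M = price M - c_p M"

locale driver_pomdp =
  fixes M :: "('k::finite, 'd, 'h) driver_model"
  assumes horizon_pos: "1 \<le> horizon M"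
    and capacity_pos: "0 < capacity M"
    and price_pos: "0 < price M"
    and c_a_pos: "0 < c_a M"
    and c_p_pos: "0 < c_p M"
    and c_b_pos: "0 < c_b M"
    and c_lost_pos: "0 < c_lost M"
    and driver_profitable: "0 < real (capacity M) * price M - real (capacity M) * c_p M - c_a M"
    and margin_pos: "0 < margin M"
    and backlog_gt_margin: "margin M < c_b M"
    and lost_gt_backlog: "c_b M < c_lost M"
    and demand_bounded:
      "\<And>t k. t \<in> {1..horizon M} \<Longrightarrow> set_pmf (demand M k (day M) (hour M t)) \<subseteq> {0..max_demand M}"
    and trans_stochastic: "row_stochastic (trans_matrix M)"
    and fallback_simplex: "\<And>t b x. fallback M t b x \<in> belief_simplex"

definition demand_prob :: "('k::finite, 'd, 'h) driver_model \<Rightarrow> nat \<Rightarrow> 'k \<Rightarrow> nat \<Rightarrow> real" where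
  "demand_prob M t k x = pmf (demand M k (day M) (hour M t)) x"

definition posterior ::
  "('k::finite, 'd, 'h) driver_model \<Rightarrow> nat \<Rightarrow> real ^ 'k \<Rightarrow> nat \<Rightarrow> real ^ 'k" where
  "posterior M t b x =
    (let w = (\<Sum>k\<in>UNIV. b $ k * demand_prob M t k x)
     in if w = 0 then fallback M t b x else (\<chi> j. b $ j * demand_prob M t j x / w))"

definition next_belief ::
  "('k::finite, 'd, 'h) driver_model \<Rightarrow> nat \<Rightarrow> real ^ 'k \<Rightarrow> nat \<Rightarrow> real ^ 'k" where
  "next_belief M t b x = transpose (trans_matrix M) *v posterior M t b x"

definition reward :: "('k::finite, 'd, 'h) driver_model \<Rightarrow> nat \<Rightarrow> nat \<Rightarrow> nat \<Rightarrow> real" where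
  "reward M x s a =
    price M * real (min (x + s) (capacity M * a)) - c_a M * real a
      - c_p M * real (min (x + s) (capacity M * a)) - c_b M * real s"

text \<open>Truncated subtraction on \<open>nat\<close> realises \<open>max {x + s - v a, 0}\<close>.\<close>

definition next_backlog :: "('k::finite, 'd, 'h) driver_model \<Rightarrow> nat \<Rightarrow> nat \<Rightarrow> nat \<Rightarrow> nat" where
  "next_backlog M x s a = x + s - capacity M * a"

definition actions :: "('k::finite, 'd, 'h) driver_model \<Rightarrow> nat set" where
  "actions M = {a. min_action M \<le> a}"

definition bellman ::
  "('k::finite, 'd, 'h) driver_model \<Rightarrow> nat \<Rightarrow> (nat \<Rightarrow> real ^ 'k \<Rightarrow> real) \<Rightarrow>
    nat \<Rightarrow> real ^ 'k \<Rightarrow> nat \<Rightarrow> real" where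
  "bellman M t W s b a =
    (\<Sum>k\<in>UNIV. b $ k *
      (\<Sum>x=0..max_demand M.
        (reward M x s a + W (next_backlog M x s a) (next_belief M t b x)) * demand_prob M t k x))"

text \<open>
  \<open>GREATEST\<close> is the maximum of a possibly infinite set (\<open>Max\<close> is only meaningful on finite ones).
  Only the periods \<open>1, \<dots>, T + 1\<close> matter; later periods get the terminal value.
\<close>

function V :: "('k::finite, 'd, 'h) driver_model \<Rightarrow> nat \<Rightarrow> nat \<Rightarrow> real ^ 'k \<Rightarrow> real" where
  "V M t =
    (if horizon M < t then (\<lambda>s b. - c_lost M * real s)
     else (\<lambda>s b. GREATEST y. \<exists>a\<in>actions M. y = bellman M t (V M (Suc t)) s b a))"
  by pat_completeness auto
termination by (relation "Wellfounded.measure (\<lambda>(M, t). Suc (horizon M) - t)") auto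

declare V.simps [simp del]

definition Q :: "('k::finite, 'd, 'h) driver_model \<Rightarrow> nat \<Rightarrow> nat \<Rightarrow> real ^ 'k \<Rightarrow> nat \<Rightarrow> real" where
  "Q M t s b a = bellman M t (V M (Suc t)) s b a"

definition opt_action :: "('k::finite, 'd, 'h) driver_model \<Rightarrow> nat \<Rightarrow> nat \<Rightarrow> real ^ 'k \<Rightarrow> nat" where
  "opt_action M t s b = (LEAST a. is_arg_max (Q M t s b) (\<lambda>a. a \<in> actions M) a)"

lemma V_terminal: "V M (Suc (horizon M)) s b = - c_lost M * real s"
  by (subst V.simps) simp

lemma V_eq_max_Q:
  assumes "t \<in> {1..horizon M}"
  shows "V M t s b = (GREATEST y. \<exists>a\<in>actions M. y = Q M t s b a)"
  using assms by (subst V.simps) (simp add: Q_def)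

end

theory Submission imports Defs
begin

text \<open>
  Since \<open>min {x + s, v a} = (x + s) - max {x + s - v a, 0}\<close>, the stage value depends on \<open>(s, a)\<close>, up
  to terms linear in \<open>s\<close> and in \<open>a\<close>, only through \<open>s - v a\<close>. Value functions are in general not
  concave in \<open>s\<close>, but they are ``concave along steps of length \<open>v\<close>'': \<open>V (s + v) - V s\<close> is
  non-increasing in \<open>s\<close>. Together with monotonicity this property of the continuation value makes
  the stage value supermodular in \<open>(s, a)\<close>, which gives the monotone smallest maximiser. Raising
  \<open>s\<close> by \<open>v\<close> and \<open>a\<close> by one changes the stage value by a constant, so the smallest maximiser grows
  by at most one when \<open>s\<close> grows by \<open>v\<close>, and \<open>V (s + v) - V s\<close> equals that constant unless the
  minimal action is optimal at \<open>s + v\<close>; hence the property passes to the previous period.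
\<close>

section \<open>One-period problem with an abstract continuation value\<close>

definition step_concave :: "nat \<Rightarrow> (nat \<Rightarrow> real) \<Rightarrow> bool" where
  "step_concave v U \<longleftrightarrow>
    (\<forall>s. U (Suc s) \<le> U s) \<and> (\<forall>s. U (Suc s + v) - U (Suc s) \<le> U (s + v) - U s)"

text \<open>The current belief is fixed and absorbed into \<open>w\<close> and \<open>U\<close>. The
  continuation \<open>U\<close> is indexed by the demand because the next belief depends on the
  demand observed.\<close>

locale allocation_stage =
  fixes v X amin :: nat and q ca cb :: real and w :: "nat \<Rightarrow> real"
    and U :: "nat \<Rightarrow> nat \<Rightarrow> real"
  assumes v_pos: "0 < v" and q_nonneg: "0 \<le> q" and ca_pos: "0 < ca" and q_less_cb: "q < cb"
    and w_nonneg: "\<And>x. 0 \<le> w x" and w_sum: "(\<Sum>x=0..X. w x) = 1"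
    and U_step_concave: "\<And>x. step_concave v (U x)"
begin

definition term_value :: "nat \<Rightarrow> nat \<Rightarrow> nat \<Rightarrow> real" where
  "term_value x s a =
    q * real (min (x + s) (v * a)) - ca * real a - cb * real s + U x (x + s - v * a)"

definition stage_value :: "nat \<Rightarrow> nat \<Rightarrow> real" where
  "stage_value s a = (\<Sum>x=0..X. w x * term_value x s a)"

definition optimal :: "nat \<Rightarrow> nat \<Rightarrow> bool" where
  "optimal s a \<longleftrightarrow> is_arg_max (stage_value s) (\<lambda>a. amin \<le> a) a"

definition least_optimal :: "nat \<Rightarrow> nat" where
  "least_optimal s = (LEAST a. optimal s a)"

definition max_value :: "nat \<Rightarrow> real" where
  "max_value s = stage_value s (least_optimal s)"

lemma U_Suc_le: "U x (Suc s) \<le> U x s"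
  using U_step_concave[of x] by (simp add: step_concave_def)

lemma U_antimono: "m \<le> n \<Longrightarrow> U x n \<le> U x m"
  by (rule lift_Suc_antimono_le[of "U x"]) (use U_Suc_le in auto)

lemma weighted_sum_add_const: "(\<Sum>x=0..X. w x * (f x + c)) = (\<Sum>x=0..X. w x * f x) + c"
proof -
  have "(\<Sum>x=0..X. w x * (f x + c)) = (\<Sum>x=0..X. w x * f x) + (\<Sum>x=0..X. w x) * c"
    by (simp add: distrib_left sum.distrib sum_distrib_right)
  then show ?thesis by (simp add: w_sum)
qed

text \<open>The additional driver serves exactly the additional \<open>v\<close> orders, so the next
  backlog is unchanged for every demand. What remains is the margin \<open>q\<close> and the backlog
  cost \<open>cb\<close> on \<open>v\<close> orders, and one wage.\<close>

lemma stage_value_shift: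
  "stage_value (s + v) (Suc a) = stage_value s a + (real v * (q - cb) - ca)"
proof -
  have "term_value x (s + v) (Suc a) = term_value x s a + (real v * (q - cb) - ca)" for x
  proof -
    have "min (x + (s + v)) (v * Suc a) = min (x + s) (v * a) + v"
      by (simp add: min_def)
    moreover have "x + (s + v) - v * Suc a = x + s - v * a"
      by simp
    ultimately show ?thesis
      unfolding term_value_def by (simp add: algebra_simps)
  qed
  then show ?thesis
    unfolding stage_value_def by (simp add: weighted_sum_add_const)
qed

text \<open>One more backlogged order earns at most \<open>q\<close>, costs \<open>cb\<close>, and
  cannot improve the continuation. The resulting loss of at least \<open>cb - q\<close> is uniform
  in the demand, so it survives averaging with weights of total 1.\<close>

lemma stage_value_strict_decreasing: "stage_value (Suc s) a < stage_value s a"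
proof -
  have "term_value x (Suc s) a \<le> term_value x s a + (q - cb)" for x
  proof -
    have "real (min (x + Suc s) (v * a)) \<le> real (min (x + s) (v * a)) + 1"
      by simp
    then have "q * real (min (x + Suc s) (v * a)) \<le> q * real (min (x + s) (v * a)) + q"
      using mult_left_mono[OF _ q_nonneg] by (fastforce simp: distrib_left)
    moreover have "U x (x + Suc s - v * a) \<le> U x (x + s - v * a)"
      by (rule U_antimono) simp
    ultimately show ?thesis
      unfolding term_value_def by (simp add: algebra_simps)
  qed
  then have "stage_value (Suc s) a \<le> (\<Sum>x=0..X. w x * (term_value x s a + (q - cb)))"
    unfolding stage_value_def by (intro sum_mono mult_left_mono w_nonneg)
  then show ?thesis
    using q_less_cb by (simp add: weighted_sum_add_const stage_value_def)
qed

text \<open>The extra driver is idle, partly busy or fully busy. Facing one more order, the driver's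
  marginal value is unchanged when idle, gains \<open>q\<close> plus an avoided backlog when partly
  busy, and is controlled by step concavity when fully busy.\<close>

lemma term_value_supermodular:
  "term_value x s (Suc a) - term_value x s a
    \<le> term_value x (Suc s) (Suc a) - term_value x (Suc s) a"
proof -
  \<comment> \<open>The upper bounds are strict so that \<open>s\<close> and \<open>Suc s\<close>
    obey the same formulas within each case.\<close>
  consider "x + s < v * a" | "v * a \<le> x + s" "x + s < v * a + v" | "v * a + v \<le> x + s"
    by linarith
  then show ?thesis
  proof cases
    case 1
    then show ?thesis unfolding term_value_def by (simp add: min_def)
  next
    case 2
    have "U x (Suc (x + s) - v * a) \<le> U x (x + s - v * a)"
      by (rule U_antimono) simp
    moreover have "x + s - v * Suc a = 0" "Suc (x + s) - v * Suc a = 0"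
      "min (x + s) (v * Suc a) = x + s" "min (Suc (x + s)) (v * Suc a) = Suc (x + s)"
      "min (x + s) (v * a) = v * a" "min (Suc (x + s)) (v * a) = v * a"
      using 2 by auto
    ultimately show ?thesis
      unfolding term_value_def using q_nonneg by (simp add: algebra_simps)
  next
    case 3
    define m where "m = x + s - v * Suc a"
    have m: "x + s = m + v + v * a" using 3 by (simp add: m_def)
    have "U x (Suc m + v) - U x (Suc m) \<le> U x (m + v) - U x m"
      using U_step_concave[of x] by (simp add: step_concave_def)
    moreover have "x + s - v * Suc a = m" "Suc (x + s) - v * Suc a = Suc m"
      "x + s - v * a = m + v" "Suc (x + s) - v * a = Suc m + v"
      "min (x + s) (v * Suc a) = v * Suc a" "min (Suc (x + s)) (v * Suc a) = v * Suc a"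
      "min (x + s) (v * a) = v * a" "min (Suc (x + s)) (v * a) = v * a"
      using m by auto
    ultimately show ?thesis
      unfolding term_value_def by (simp add: algebra_simps)
  qed
qed

lemma stage_value_supermodular:
  "stage_value s (Suc a) - stage_value s a
    \<le> stage_value (Suc s) (Suc a) - stage_value (Suc s) a"
  unfolding stage_value_def sum_subtractf[symmetric] right_diff_distrib[symmetric]
  by (intro sum_mono mult_left_mono w_nonneg term_value_supermodular)

lemma stage_value_supermodular_le:
  assumes "a \<le> a'"
  shows "stage_value s a' - stage_value s a \<le> stage_value (Suc s) a' - stage_value (Suc s) a"
  using assms
proof (induction a' rule: dec_induct)
  case (step n)
  then show ?case using stage_value_supermodular[of s n] by linarith
qed simp

lemma stage_value_Suc_action_le:
  assumes "X + s \<le> v * a"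
  shows "stage_value s (Suc a) \<le> stage_value s a"
proof -
  have "term_value x s (Suc a) \<le> term_value x s a" if "x \<in> {0..X}" for x
  proof -
    have "x + s \<le> v * a" using assms that by simp
    then show ?thesis
      unfolding term_value_def using ca_pos by (simp add: min_def algebra_simps)
  qed
  then show ?thesis
    unfolding stage_value_def by (intro sum_mono mult_left_mono w_nonneg)
qed

section \<open>Maximisers and the maximal value of one period\<close>

lemma optimal_iff:
  "optimal s a \<longleftrightarrow> amin \<le> a \<and> (\<forall>a'\<ge>amin. stage_value s a' \<le> stage_value s a)"
  by (auto simp: optimal_def is_arg_max_linorder)

lemma optimal_exists: "\<exists>a. optimal s a"
proof -
  \<comment> \<open>From \<open>X + s\<close> drivers on, every order is served even if
    \<open>v = 1\<close>, so further drivers only add wages. Adding \<open>amin\<close> makes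
    \<open>N\<close> itself feasible, and the search reduces to a finite interval.\<close>
  define N where "N = amin + X + s"
  have enough: "X + s \<le> v * n" if "N \<le> n" for n
  proof -
    have "n \<le> v * n" using v_pos by simp
    then show ?thesis using that unfolding N_def by linarith
  qed
  have beyond: "stage_value s n \<le> stage_value s N" if "N \<le> n" for n
    using that
  proof (induction n rule: dec_induct)
    case (step n)
    then show ?case using stage_value_Suc_action_le[OF enough] by fastforce
  qed simp
  have "finite (stage_value s ` {amin..N})" "stage_value s ` {amin..N} \<noteq> {}"
    by (auto simp: N_def)
  then have "Max (stage_value s ` {amin..N}) \<in> stage_value s ` {amin..N}"
    by (rule Max_in)
  then obtain a where a: "a \<in> {amin..N}" "stage_value s a = Max (stage_value s ` {amin..N})"
    by auto
  have below: "stage_value s a' \<le> stage_value s a" if "a' \<in> {amin..N}" for a'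
    using that a(2) by simp
  have "stage_value s a' \<le> stage_value s a" if "amin \<le> a'" for a'
  proof (cases "a' \<le> N")
    case True
    then show ?thesis using below that by simp
  next
    case False
    then have "stage_value s a' \<le> stage_value s N" using beyond by simp
    also have "\<dots> \<le> stage_value s a" by (rule below) (simp add: N_def)
    finally show ?thesis .
  qed
  then show ?thesis using a(1) by (auto simp: optimal_iff)
qed

lemma least_optimal_optimal: "optimal s (least_optimal s)"
  unfolding least_optimal_def by (rule LeastI_ex[OF optimal_exists])

lemma least_optimal_ge: "amin \<le> least_optimal s"
  using least_optimal_optimal by (simp add: optimal_iff)

lemma stage_value_le_max: "amin \<le> a \<Longrightarrow> stage_value s a \<le> max_value s"
  using least_optimal_optimal unfolding max_value_def by (simp add: optimal_iff)

lemma stage_value_less_max: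
  assumes "amin \<le> a" "a < least_optimal s"
  shows "stage_value s a < max_value s"
proof (rule ccontr)
  assume "\<not> stage_value s a < max_value s"
  then have "optimal s a"
    using assms(1) stage_value_le_max[of _ s] by (fastforce simp: optimal_iff)
  then show False
    using assms(2) not_less_Least unfolding least_optimal_def by blast
qed

text \<open>Topkis' argument: if the least maximiser dropped, going from the lower action back up to
  the old one would be a strict gain at \<open>s\<close> by minimality, hence also at
  \<open>Suc s\<close> by supermodularity, against optimality there.\<close>

lemma least_optimal_Suc: "least_optimal s \<le> least_optimal (Suc s)"
proof (rule ccontr)
  assume "\<not> ?thesis"
  then have less: "least_optimal (Suc s) < least_optimal s" by simp
  have "stage_value s (least_optimal (Suc s)) < stage_value s (least_optimal s)"
    using stage_value_less_max[OF least_optimal_ge less] by (simp add: max_value_def)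
  moreover have "stage_value (Suc s) (least_optimal s)
      \<le> stage_value (Suc s) (least_optimal (Suc s))"
    using stage_value_le_max[OF least_optimal_ge] by (simp add: max_value_def)
  ultimately show False
    using stage_value_supermodular_le[of "least_optimal (Suc s)" "least_optimal s" s] less
    by linarith
qed

lemma least_optimal_mono: "s \<le> s' \<Longrightarrow> least_optimal s \<le> least_optimal s'"
  by (rule lift_Suc_mono_le[of least_optimal]) (use least_optimal_Suc in auto)

text \<open>If two or more drivers were added, removing one driver together with the
  \<open>v\<close> extra orders would give an action strictly better at \<open>s\<close> than the
  optimal one.\<close>

lemma least_optimal_shift_le: "least_optimal (s + v) \<le> Suc (least_optimal s)"
proof (rule ccontr)
  assume "\<not> ?thesis"
  then have less: "Suc (least_optimal s) < least_optimal (s + v)" by simp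
  then obtain a where a: "least_optimal (s + v) = Suc a" by (cases "least_optimal (s + v)") auto
  have "stage_value (s + v) (Suc (least_optimal s)) < stage_value (s + v) (Suc a)"
    using stage_value_less_max[OF _ less] least_optimal_ge[of s] by (simp add: max_value_def a)
  then have "max_value s < stage_value s a"
    by (simp add: stage_value_shift max_value_def)
  moreover have "stage_value s a \<le> max_value s"
    using stage_value_le_max[of a s] least_optimal_ge[of s] less a by simp
  ultimately show False by simp
qed

lemma max_value_Suc_less: "max_value (Suc s) < max_value s"
proof -
  have "max_value (Suc s) < stage_value s (least_optimal (Suc s))"
    unfolding max_value_def by (rule stage_value_strict_decreasing)
  also have "\<dots> \<le> max_value s" by (rule stage_value_le_max[OF least_optimal_ge])
  finally show ?thesis .
qed

lemma max_value_strict_decreasing: "s < s' \<Longrightarrow> max_value s' < max_value s"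
  using lift_Suc_mono_less[of "\<lambda>s. - max_value s" s s'] max_value_Suc_less by simp

text \<open>Adding a driver is always feasible, so this bound is unconditional; the reverse bound
  needs a driver to remove, which fails at \<open>amin\<close>.\<close>

lemma max_value_shift_ge: "max_value s + (real v * (q - cb) - ca) \<le> max_value (s + v)"
  using stage_value_le_max[of "Suc (least_optimal s)" "s + v"] least_optimal_ge[of s]
  by (simp add: stage_value_shift max_value_def)

lemma max_value_step_concave: "step_concave v max_value"
proof -
  have "max_value (Suc s + v) - max_value (Suc s) \<le> max_value (s + v) - max_value s" for s
  proof (cases "least_optimal (Suc s + v) = amin")
    case True
    \<comment> \<open>By monotonicity \<open>amin\<close> is the least maximiser at all four
      backlogs in the claim. The shift identity, applied to action \<open>Suc amin\<close>, then
      turns supermodularity at \<open>s + v\<close> into the claim.\<close>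
    have amin: "least_optimal n = amin" if "n \<le> Suc s + v" for n
      using least_optimal_mono[OF that] least_optimal_ge[of n] True by simp
    have "stage_value (s + v) (Suc amin) - stage_value (s + v) amin
        \<le> stage_value (Suc s + v) (Suc amin) - stage_value (Suc s + v) amin"
      using stage_value_supermodular[of "s + v" amin] by simp
    then show ?thesis
      unfolding max_value_def stage_value_shift by (simp add: amin)
  next
    case False
    then obtain a where a: "least_optimal (Suc s + v) = Suc a" "amin \<le> a"
      using least_optimal_ge[of "Suc s + v"] by (cases "least_optimal (Suc s + v)") auto
    \<comment> \<open>Here a driver can be removed, so the increment at \<open>Suc s\<close> is at
      most the shift constant, while the increment at \<open>s\<close> is at least that
      constant.\<close>
    have "max_value (Suc s + v) = stage_value (Suc s) a + (real v * (q - cb) - ca)"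
      unfolding max_value_def a(1) by (rule stage_value_shift)
    moreover have "stage_value (Suc s) a \<le> max_value (Suc s)"
      by (rule stage_value_le_max[OF a(2)])
    ultimately show ?thesis using max_value_shift_ge[of s] by linarith
  qed
  then show ?thesis
    unfolding step_concave_def using max_value_Suc_less less_imp_le by blast
qed

end

section \<open>Predictive law of demand and belief updates\<close>

definition demand_weight ::
  "('k::finite, 'd, 'h) driver_model \<Rightarrow> nat \<Rightarrow> real ^ 'k \<Rightarrow> nat \<Rightarrow> real" where
  "demand_weight M t b x = (\<Sum>k\<in>UNIV. b $ k * demand_prob M t k x)"

lemma demand_weight_nonneg: "b \<in> belief_simplex \<Longrightarrow> 0 \<le> demand_weight M t b x"
  unfolding demand_weight_def belief_simplex_def demand_prob_def
  by (auto intro!: sum_nonneg)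

context driver_pomdp
begin

lemma demand_weight_sum:
  assumes "t \<in> {1..horizon M}" "b \<in> belief_simplex"
  shows "(\<Sum>x=0..max_demand M. demand_weight M t b x) = 1"
proof -
  have "(\<Sum>x=0..max_demand M. demand_prob M t k x) = 1" for k
    unfolding demand_prob_def by (rule sum_pmf_eq_1) (use demand_bounded[OF assms(1)] in auto)
  moreover have "(\<Sum>x=0..max_demand M. demand_weight M t b x)
      = (\<Sum>k\<in>UNIV. b $ k * (\<Sum>x=0..max_demand M. demand_prob M t k x))"
    unfolding demand_weight_def by (subst sum.swap) (simp add: sum_distrib_left)
  ultimately show ?thesis using assms(2) by (simp add: belief_simplex_def)
qed

lemma posterior_simplex:
  assumes "b \<in> belief_simplex"
  shows "posterior M t b x \<in> belief_simplex"
proof (cases "demand_weight M t b x = 0")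
  case True
  then show ?thesis
    using fallback_simplex by (simp add: posterior_def demand_weight_def Let_def)
next
  case False
  have "0 \<le> b $ k * demand_prob M t k x / demand_weight M t b x" for k
    using assms demand_weight_nonneg[OF assms, of M t x]
    by (simp add: belief_simplex_def demand_prob_def)
  moreover have "(\<Sum>k\<in>UNIV. b $ k * demand_prob M t k x / demand_weight M t b x) = 1"
    using False unfolding sum_divide_distrib[symmetric] by (simp add: demand_weight_def)
  ultimately show ?thesis
    using False by (simp add: posterior_def demand_weight_def Let_def belief_simplex_def)
qed

text \<open>Step concavity of the next value function is available only for beliefs in the simplex,
  so updating must not leave it.\<close>

lemma next_belief_simplex:
  assumes "b \<in> belief_simplex"
  shows "next_belief M t b x \<in> belief_simplex"
proof -
  define \<beta> where "\<beta> = posterior M t b x"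
  have \<beta>: "\<And>k. 0 \<le> \<beta> $ k" "(\<Sum>k\<in>UNIV. \<beta> $ k) = 1"
    using posterior_simplex[OF assms] by (auto simp: \<beta>_def belief_simplex_def)
  have P: "\<And>i j. 0 \<le> trans_matrix M $ i $ j" "\<And>i. (\<Sum>j\<in>UNIV. trans_matrix M $ i $ j) = 1"
    using trans_stochastic by (auto simp: row_stochastic_def)
  have component: "next_belief M t b x $ j = (\<Sum>i\<in>UNIV. trans_matrix M $ i $ j * \<beta> $ i)" for j
    by (simp add: next_belief_def \<beta>_def matrix_vector_mult_def transpose_def)
  have "(\<Sum>j\<in>UNIV. next_belief M t b x $ j)
      = (\<Sum>i\<in>UNIV. (\<Sum>j\<in>UNIV. trans_matrix M $ i $ j) * \<beta> $ i)"
    unfolding component by (subst sum.swap) (simp add: sum_distrib_right)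
  then show ?thesis
    using \<beta> P by (simp add: belief_simplex_def component sum_nonneg)
qed

section \<open>Reduction of the model to the abstract stage, and backward induction\<close>

abbreviation continuation :: "nat \<Rightarrow> real ^ 'k \<Rightarrow> nat \<Rightarrow> nat \<Rightarrow> real" where
  "continuation t b x s \<equiv> V M (Suc t) s (next_belief M t b x)"

lemma allocation_stage:
  assumes "t \<in> {1..horizon M}" "b \<in> belief_simplex"
    and "\<And>b'. b' \<in> belief_simplex \<Longrightarrow> step_concave (capacity M) (\<lambda>s. V M (Suc t) s b')"
  shows "allocation_stage (capacity M) (max_demand M) (margin M) (c_a M) (c_b M)
    (demand_weight M t b) (continuation t b)"
  by unfold_locales
    (use assms capacity_pos margin_pos c_a_pos backlog_gt_margin in
      \<open>auto simp: demand_weight_nonneg demand_weight_sum next_belief_simplex\<close>)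

text \<open>The stage property is a hypothesis because inside the backward induction it comes from
  the induction hypothesis.\<close>

lemma stage_equations:
  assumes t: "t \<in> {1..horizon M}"
    and stage: "allocation_stage (capacity M) (max_demand M) (margin M) (c_a M) (c_b M)
      (demand_weight M t b) (continuation t b)"
  defines "best \<equiv> allocation_stage.max_value (capacity M) (max_demand M) (min_action M)
      (margin M) (c_a M) (c_b M) (demand_weight M t b) (continuation t b)"
    and "action \<equiv> allocation_stage.least_optimal (capacity M) (max_demand M) (min_action M)
      (margin M) (c_a M) (c_b M) (demand_weight M t b) (continuation t b)"
  shows "V M t s b = best s" and "opt_action M t s b = action s"
proof -
  interpret allocation_stage "capacity M" "max_demand M" "min_action M" "margin M" "c_a M" "c_b M"
    "demand_weight M t b" "continuation t b"
    by (rule stage)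
  have "reward M x s a + V M (Suc t) (next_backlog M x s a) (next_belief M t b x)
      = term_value x s a" for x a
    unfolding reward_def next_backlog_def term_value_def by (simp add: margin_def algebra_simps)
  \<comment> \<open>Exchanging the sums over regimes and demands merges belief and regime laws into
    \<open>demand_weight\<close>.\<close>
  then have Q: "Q M t s b a = stage_value s a" for a
    unfolding Q_def bellman_def stage_value_def demand_weight_def sum_distrib_right sum_distrib_left
    by (subst sum.swap) (simp add: mult_ac)
  show "opt_action M t s b = action s"
    unfolding opt_action_def action_def least_optimal_def optimal_def
    by (simp add: Q[abs_def] actions_def)
  show "V M t s b = best s"
    unfolding V_eq_max_Q[OF t] Q best_def
    \<comment> \<open>The least maximiser attains the value, and \<open>stage_value_le_max\<close>
      makes it an upper bound, so \<open>GREATEST\<close> is a true maximum.\<close>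
    by (rule Greatest_equality)
      (use stage_value_le_max least_optimal_ge in \<open>auto simp: actions_def max_value_def\<close>)
qed

text \<open>The index \<open>Suc t\<close> lets the induction start at the terminal period and
  matches the continuation of period \<open>t\<close>. The belief is arbitrary because the
  hypothesis is needed at every updated belief.\<close>

lemma V_step_concave:
  assumes "t \<le> horizon M" "b \<in> belief_simplex"
  shows "step_concave (capacity M) (\<lambda>s. V M (Suc t) s b)"
  using assms
proof (induction t arbitrary: b rule: inc_induct)
  case base
  then show ?case
    \<comment> \<open>The terminal value is linear in the backlog, so its increments over
      \<open>v\<close> are constant.\<close>
    using c_lost_pos by (simp add: step_concave_def V_terminal algebra_simps)
next
  case (step t)
  have t: "Suc t \<in> {1..horizon M}" using step by simp
  have stage: "allocation_stage (capacity M) (max_demand M) (margin M) (c_a M) (c_b M)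
      (demand_weight M (Suc t) b) (continuation (Suc t) b)"
    using allocation_stage[OF t] step by simp
  show ?case
    unfolding stage_equations(1)[OF t stage]
    using allocation_stage.max_value_step_concave[OF stage] .
qed

end

theorem theorem1:
  fixes M :: "('k::finite, 'd, 'h) driver_model" and t :: nat and b :: "real ^ 'k"
  assumes "driver_pomdp M"
    and "t \<in> {1..horizon M}"
    and "b \<in> belief_simplex"
  shows "(\<forall>s s'. s < s' \<longrightarrow> V M t s' b < V M t s b)
    \<and> (\<forall>s s'. s \<le> s' \<longrightarrow> opt_action M t s b \<le> opt_action M t s' b)
    \<and> (\<forall>s. opt_action M t s b \<le> opt_action M t (s + capacity M) b
         \<and> opt_action M t (s + capacity M) b \<le> opt_action M t s b + 1)"
proof -
  interpret driver_pomdp M by (rule assms(1))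
  have stage: "allocation_stage (capacity M) (max_demand M) (margin M) (c_a M) (c_b M)
      (demand_weight M t b) (continuation t b)"
    using allocation_stage[OF assms(2,3)] V_step_concave assms(2) by simp
  interpret allocation_stage "capacity M" "max_demand M" "min_action M" "margin M" "c_a M" "c_b M"
    "demand_weight M t b" "continuation t b"
    by (rule stage)
  show ?thesis
    unfolding stage_equations[OF assms(2) stage]
    using max_value_strict_decreasing least_optimal_mono least_optimal_shift_le by simp
qed

end
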